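(* Let $d$ and $n$ be positive integers with $d\mid n$, let $\zeta\in\mathbb{C}$ be a primitive $d$-th root of unity, and let $T$ be a cycle on $[n]=\{1,\dots,n\}$. Then $$\sigma(d;T)=g_T(\zeta,\zeta^2,\dots,\zeta^d).$$
   Context: A cycle on $[n]$ is a permutation of $[n]$ whose disjoint cycle decomposition consists of exactly one cycle (of length $n$). For an endofunction $T$ on a set of size $n$ with $d\mid n$, a subset $W$ of cardinality $n/d$ is $d$-splitting if $W\cup TW\cup\cdots\cup T^{d-1}W$ is the whole set ($T^i$ is the $i$-fold composition); $\sigma(d;T)$ is the number of $d$-splitting subsets. A subset $U$ is $T$-invariant if $TU\subseteq U$. A $d$-flag of $T$-invariant subsets of $[n]$ is a sequence $\emptyset=U_0\subseteq U_1\subseteq\cdots\subseteq U_{d-1}\subseteq U_d=[n]$ with every $U_i$ $T$-invariant. The generating function of $d$-flags is $g_T(t_1,\dots,t_d)=\sum_J a_J\,t_1^{j_1}\cdots t_d^{j_d}$, the sum over $d$-tuples $J=(j_1,\dots,j_d)$ of non-negative integers, where $a_J$ is the number of $d$-flags with $|U_i|=j_1+\cdots+j_i$ for all $1\le i\le d$. *)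

theory Defs
  imports Complex_Main "HOL-Library.FuncSet" "HOL-Combinatorics.Combinatorics"
begin

text \<open>
  Permutations of \<open>S\<close> are total functions fixing every point outside \<open>S\<close>. The list \<open>cs\<close> is the
  only cycle of the decomposition and lists all of \<open>S\<close>, so a one-element set has the identity as
  its cycle (of length one).
\<close>

definition is_cycle_on :: "('a \<Rightarrow> 'a) \<Rightarrow> 'a set \<Rightarrow> bool" where
  "is_cycle_on T S \<longleftrightarrow>
     T permutes S \<and> (\<exists>cs. distinct cs \<and> set cs = S \<and> T = cycle_of_list cs)"

definition primitive_root_of_unity :: "nat \<Rightarrow> 'a::comm_ring_1 \<Rightarrow> bool" where
  "primitive_root_of_unity d z \<longleftrightarrow> 0 < d \<and> z ^ d = 1 \<and> (\<forall>k. 0 < k \<and> k < d \<longrightarrow> z ^ k \<noteq> 1)"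

text \<open>The truncating division is intended for \<open>d dvd card S\<close> only.\<close>

definition splitting_subset :: "nat \<Rightarrow> ('a \<Rightarrow> 'a) \<Rightarrow> 'a set \<Rightarrow> 'a set \<Rightarrow> bool" where
  "splitting_subset d T S W \<longleftrightarrow>
     W \<subseteq> S \<and> card W = card S div d \<and> (\<Union>i<d. (T ^^ i) ` W) = S"

definition num_splitting :: "nat \<Rightarrow> ('a \<Rightarrow> 'a) \<Rightarrow> 'a set \<Rightarrow> nat" where
  "num_splitting d T S = card {W. splitting_subset d T S W}"

definition invariant_subset :: "('a \<Rightarrow> 'a) \<Rightarrow> 'a set \<Rightarrow> 'a set \<Rightarrow> bool" where
  "invariant_subset T S U \<longleftrightarrow> U \<subseteq> S \<and> T ` U \<subseteq> U"

text \<open>Sequences are extensional functions on their index set, so that counting them is meaningful.\<close>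

definition invariant_flags :: "nat \<Rightarrow> ('a \<Rightarrow> 'a) \<Rightarrow> 'a set \<Rightarrow> (nat \<Rightarrow> 'a set) set" where
  "invariant_flags d T S =
     {U \<in> {0..d} \<rightarrow>\<^sub>E {V. invariant_subset T S V}.
        U 0 = {} \<and> U d = S \<and> (\<forall>i<d. U i \<subseteq> U (Suc i))}"

definition num_flags :: "nat \<Rightarrow> ('a \<Rightarrow> 'a) \<Rightarrow> 'a set \<Rightarrow> (nat \<Rightarrow> nat) \<Rightarrow> nat" where
  "num_flags d T S J =
     card {U \<in> invariant_flags d T S. \<forall>i\<in>{1..d}. card (U i) = (\<Sum>k=1..i. J k)}"

text \<open>
  The sum over all \<open>d\<close>-tuples \<open>J\<close> is restricted to the tuples with nonzero coefficient, a finite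
  set for finite \<open>S\<close> and \<open>d > 0\<close> (lemma \<open>finite_flag_support\<close> below); the variable \<open>t\<^sub>i\<close> is \<open>t i\<close>.
\<close>

definition flag_genfun ::
    "nat \<Rightarrow> ('a \<Rightarrow> 'a) \<Rightarrow> 'a set \<Rightarrow> (nat \<Rightarrow> 'b::comm_semiring_1) \<Rightarrow> 'b" where
  "flag_genfun d T S t =
     (\<Sum>J | J \<in> ({1..d} \<rightarrow>\<^sub>E (UNIV :: nat set)) \<and> num_flags d T S J \<noteq> 0.
        of_nat (num_flags d T S J) * (\<Prod>i=1..d. t i ^ J i))"

lemma finite_invariant_flags:
  assumes "finite S"
  shows "finite (invariant_flags d T S)"
proof (rule finite_subset)
  show "invariant_flags d T S \<subseteq> ({0..d} \<rightarrow>\<^sub>E Pow S)"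
    by (auto simp: invariant_flags_def invariant_subset_def PiE_def Pi_def)
  show "finite ({0..d} \<rightarrow>\<^sub>E Pow S)"
    using assms by (intro finite_PiE) auto
qed

lemma finite_flag_support:
  assumes "finite S" and "d > 0"
  shows "finite {J. J \<in> ({1..d} \<rightarrow>\<^sub>E (UNIV :: nat set)) \<and> num_flags d T S J \<noteq> 0}"
proof (rule finite_subset)
  show "{J. J \<in> ({1..d} \<rightarrow>\<^sub>E (UNIV :: nat set)) \<and> num_flags d T S J \<noteq> 0}
          \<subseteq> ({1..d} \<rightarrow>\<^sub>E {..card S})"
  proof
    fix J assume "J \<in> {J. J \<in> ({1..d} \<rightarrow>\<^sub>E (UNIV :: nat set)) \<and> num_flags d T S J \<noteq> 0}"
    then have J: "J \<in> {1..d} \<rightarrow>\<^sub>E (UNIV :: nat set)" and nz: "num_flags d T S J \<noteq> 0"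
      by auto
    have "{U \<in> invariant_flags d T S. \<forall>i\<in>{1..d}. card (U i) = (\<Sum>k=1..i. J k)} \<noteq> {}"
      using nz unfolding num_flags_def by (metis card.empty)
    then obtain U where U: "U \<in> invariant_flags d T S"
      and c: "\<forall>i\<in>{1..d}. card (U i) = (\<Sum>k=1..i. J k)"
      by auto
    have "U d = S"
      using U by (simp add: invariant_flags_def)
    moreover have "card (U d) = (\<Sum>k=1..d. J k)"
      using c assms(2) by simp
    ultimately have s: "(\<Sum>k=1..d. J k) = card S"
      by simp
    have "J k \<le> card S" if "k \<in> {1..d}" for k
      using member_le_sum[of k "{1..d}" J] that s by simp
    then show "J \<in> {1..d} \<rightarrow>\<^sub>E {..card S}"
      using J by (auto simp: PiE_def Pi_def)
  qed
  show "finite ({1..d} \<rightarrow>\<^sub>E {..card S})"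
    by (intro finite_PiE) auto
qed

end

(*
  Both sides equal d. A cycle has no invariant subsets except the empty set and the whole set, so
  a d-flag is determined by the index k at which it jumps; it contributes \<zeta>^(k*n) = 1. On the other
  side, by counting, the images W, T W, ..., T^(d-1) W of a splitting subset are pairwise disjoint,
  which forces T^d W = W, and then W is one of the d orbits of T^d.
*)
theory Submission
  imports Defs
begin

section \<open>Iterates of a cycle\<close>

lemma is_cycle_on_finite: "is_cycle_on T S \<Longrightarrow> finite S"
  unfolding is_cycle_on_def by auto

lemma is_cycle_on_bij: "is_cycle_on T S \<Longrightarrow> bij (T ^^ i)"
  unfolding is_cycle_on_def using permutes_bij bij_fn by blast

lemma is_cycle_on_funpow_in:
  assumes "is_cycle_on T S" "x \<in> S"
  shows "(T ^^ i) x \<in> S"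
  using assms by (induction i) (auto simp: is_cycle_on_def permutes_in_image)

text \<open>Mapping the cycle over its own list rotates that list by one place, so the k-th power
  acts as \<open>rotate k\<close> on positions.\<close>

lemma cycle_of_list_funpow_nth:
  assumes "distinct cs" "j < length cs"
  shows "(cycle_of_list cs ^^ k) (cs ! j) = cs ! ((k + j) mod length cs)"
proof -
  have "(cycle_of_list cs ^^ k) (cs ! j) = map (cycle_of_list cs ^^ k) cs ! j"
    using assms by simp
  also have "\<dots> = rotate k cs ! j"
    using assms cyclic_rotation by metis
  finally show ?thesis
    using assms by (simp add: nth_rotate add.commute)
qed

text \<open>If x is entry k of the cycle's list, then \<open>(T ^^ i) x\<close> is entry i + k
  modulo the length. The entries are distinct, so equality of iterates is a congruence, from which k
  cancels.\<close>

lemma is_cycle_on_funpow_eq_iff: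
  assumes "is_cycle_on T S" "x \<in> S"
  shows "(T ^^ i) x = (T ^^ j) x \<longleftrightarrow> i mod card S = j mod card S"
proof -
  obtain cs where cs: "distinct cs" "set cs = S" "T = cycle_of_list cs"
    using assms by (auto simp: is_cycle_on_def)
  have len: "length cs = card S"
    using cs distinct_card by metis
  obtain k where k: "k < card S" "x = cs ! k"
    using assms cs len by (metis in_set_conv_nth)
  have pow: "(T ^^ i) x = cs ! ((i + k) mod card S)" for i
    using cycle_of_list_funpow_nth cs k len by metis
  have "(T ^^ i) x = (T ^^ j) x \<longleftrightarrow> (i + k) mod card S = (j + k) mod card S"
    unfolding pow using cs(1) len k(1) by (subst nth_eq_iff_index_eq) auto
  also have "\<dots> \<longleftrightarrow> i mod card S = j mod card S"
  proof
    assume "(i + k) mod card S = (j + k) mod card S"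
    \<comment> \<open>Adding \<open>card S - k\<close> completes k to \<open>card S\<close>, which
      vanishes modulo \<open>card S\<close>; this cancels k without subtraction.\<close>
    then have "(i + k + (card S - k)) mod card S = (j + k + (card S - k)) mod card S"
      by (rule mod_add_cong) simp
    then show "i mod card S = j mod card S"
      using k(1) by simp
  qed (rule mod_add_cong, simp_all)
  finally show ?thesis .
qed

text \<open>The first \<open>card S\<close> iterates of x are pairwise distinct elements of S, so
  they exhaust it.\<close>

lemma is_cycle_on_funpow_surj:
  assumes "is_cycle_on T S" "x \<in> S" "y \<in> S"
  obtains i where "y = (T ^^ i) x"
proof -
  let ?f = "\<lambda>i. (T ^^ i) x"
  have "inj_on ?f {..<card S}"
    using is_cycle_on_funpow_eq_iff[OF assms(1,2)] by (auto simp: inj_on_def)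
  then have "card (?f ` {..<card S}) = card S"
    by (simp add: card_image)
  moreover have "?f ` {..<card S} \<subseteq> S"
    using is_cycle_on_funpow_in[OF assms(1,2)] by auto
  ultimately have "?f ` {..<card S} = S"
    using card_subset_eq is_cycle_on_finite assms(1) by metis
  then show thesis
    using assms(3) that by blast
qed

text \<open>A nonempty invariant subset contains every iterate of one of its points, and these fill
  S by transitivity.\<close>

lemma is_cycle_on_invariant_subset_iff:
  assumes "is_cycle_on T S"
  shows "invariant_subset T S U \<longleftrightarrow> U = {} \<or> U = S"
proof
  assume U: "invariant_subset T S U"
  have "S \<subseteq> U" if "x \<in> U" for x
  proof
    fix y assume "y \<in> S"
    moreover have "(T ^^ i) x \<in> U" for i
      using that U by (induction i) (auto simp: invariant_subset_def)
    ultimately show "y \<in> U"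
      using is_cycle_on_funpow_surj[OF assms, of x y] that U
      by (auto simp: invariant_subset_def)
  qed
  then show "U = {} \<or> U = S"
    using U by (auto simp: invariant_subset_def)
next
  show "U = {} \<or> U = S \<Longrightarrow> invariant_subset T S U"
    using is_cycle_on_funpow_in[OF assms, of _ 1] by (auto simp: invariant_subset_def)
qed

section \<open>Splitting subsets of a cycle\<close>

text \<open>The orbit of x under \<open>T ^^ d\<close>. Forward iterates suffice for a cycle, as
  they are periodic; letting j range over all naturals avoids fixing the period.\<close>

definition power_orbit :: "nat \<Rightarrow> ('a \<Rightarrow> 'a) \<Rightarrow> 'a \<Rightarrow> 'a set" where
  "power_orbit d T x = (\<lambda>j. (T ^^ (d * j)) x) ` UNIV"

lemma in_power_orbit: "x \<in> power_orbit d T x"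
  unfolding power_orbit_def by (rule image_eqI[of _ _ 0]) auto

lemma funpow_image_power_orbit: "(T ^^ i) ` power_orbit d T x = power_orbit d T ((T ^^ i) x)"
proof -
  have "(T ^^ i) ((T ^^ (d * j)) x) = (T ^^ (d * j)) ((T ^^ i) x)" for j
    by (metis add.commute comp_apply funpow_add)
  then show ?thesis
    by (simp add: power_orbit_def image_image)
qed

text \<open>With \<open>card S = d * m\<close>, the points with parameters i and j coincide iff i
  and j agree modulo m, so j < m runs through the orbit exactly once.\<close>

lemma card_power_orbit:
  assumes "is_cycle_on T S" "x \<in> S" "d > 0" "d dvd card S"
  shows "card (power_orbit d T x) = card S div d"
proof -
  let ?m = "card S div d" and ?f = "\<lambda>j. (T ^^ (d * j)) x"
  have "card S > 0"
    using assms is_cycle_on_finite by (auto simp: card_gt_0_iff)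
  then have m: "card S = d * ?m" "?m > 0"
    using assms by (auto simp: div_greater_zero_iff dvd_imp_le)
  have f: "?f i = ?f j \<longleftrightarrow> i mod ?m = j mod ?m" for i j
    using is_cycle_on_funpow_eq_iff[OF assms(1,2)] m(1) assms(3)
    by (metis mult_cancel1 mult_mod_right not_gr_zero)
  have "power_orbit d T x = ?f ` {..<?m}"
  proof
    show "power_orbit d T x \<subseteq> ?f ` {..<?m}"
    proof
      fix y assume "y \<in> power_orbit d T x"
      then obtain j where "y = ?f j"
        by (auto simp: power_orbit_def)
      then have "y = ?f (j mod ?m)"
        using f by simp
      then show "y \<in> ?f ` {..<?m}"
        using m(2) by auto
    qed
  qed (auto simp: power_orbit_def)
  moreover have "inj_on ?f {..<?m}"
    using f by (auto simp: inj_on_def)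
  ultimately show ?thesis
    by (simp add: card_image)
qed

text \<open>Division of the exponent i by d writes any \<open>(T ^^ i) x\<close> as a translate by
  \<open>i mod d\<close> of a point of the orbit.\<close>

lemma splitting_subset_power_orbit:
  assumes "is_cycle_on T S" "x \<in> S" "d > 0" "d dvd card S"
  shows "splitting_subset d T S (power_orbit d T x)"
proof -
  have sub: "(T ^^ i) ` power_orbit d T x \<subseteq> S" for i
    using is_cycle_on_funpow_in[OF assms(1)] assms(2) by (auto simp: power_orbit_def)
  moreover have "y \<in> (\<Union>i<d. (T ^^ i) ` power_orbit d T x)" if y: "y \<in> S" for y
  proof -
    obtain i where i: "y = (T ^^ i) x"
      using is_cycle_on_funpow_surj[OF assms(1,2) y] .
    have "y = (T ^^ (i mod d)) ((T ^^ (d * (i div d))) x)"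
      unfolding i by (metis add.commute comp_apply funpow_add mult_div_mod_eq)
    then have "y \<in> (T ^^ (i mod d)) ` power_orbit d T x"
      by (auto simp: power_orbit_def)
    then show ?thesis
      using assms(3) by (auto intro!: UN_I[of "i mod d"])
  qed
  ultimately show ?thesis
    using sub[of 0] card_power_orbit[OF assms] by (auto simp: splitting_subset_def)
qed

text \<open>The equality case of the union bound: keeping \<open>A i\<close> and \<open>A j\<close>
  together and bounding the rest by \<open>?B\<close> shows that their union is as large as the sum
  of their sizes.\<close>

lemma disjoint_if_card_UN_eq:
  assumes "finite I" "\<And>i. i \<in> I \<Longrightarrow> finite (A i)" "card (\<Union>i\<in>I. A i) = (\<Sum>i\<in>I. card (A i))"
    and "i \<in> I" "j \<in> I" "i \<noteq> j"
  shows "A i \<inter> A j = {}"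
proof -
  let ?B = "\<Union>k\<in>I - {i, j}. A k"
  have "(\<Union>k\<in>I. A k) = (A i \<union> A j) \<union> ?B"
    using assms(4,5) by auto
  then have "card (\<Union>k\<in>I. A k) \<le> card (A i \<union> A j) + card ?B"
    by (simp add: card_Un_le)
  also have "card ?B \<le> (\<Sum>k\<in>I - {i, j}. card (A k))"
    using assms(1) by (intro card_UN_le) auto
  finally have "(\<Sum>k\<in>I. card (A k)) \<le> card (A i \<union> A j) + (\<Sum>k\<in>I - {i, j}. card (A k))"
    using assms(3) by simp
  moreover have "(\<Sum>k\<in>I. card (A k)) = (\<Sum>k\<in>I - {i, j}. card (A k)) + (\<Sum>k\<in>{i, j}. card (A k))"
    using assms(1,4,5) by (intro sum.subset_diff) auto
  ultimately have "card (A i) + card (A j) \<le> card (A i \<union> A j)"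
    using assms(6) by simp
  then show ?thesis
    using card_Un_Int[of "A i" "A j"] assms(2,4,5) by simp
qed

text \<open>Each of the d images has \<open>card S div d\<close> elements by injectivity. Their
  sizes add up to \<open>card S\<close>, so covering S leaves no room for overlap.\<close>

lemma splitting_subset_disjoint:
  assumes "is_cycle_on T S" "d dvd card S" "splitting_subset d T S W"
    and "i < d" "j < d" "i \<noteq> j"
  shows "(T ^^ i) ` W \<inter> (T ^^ j) ` W = {}"
proof (rule disjoint_if_card_UN_eq[of "{..<d}"])
  have fin: "finite W"
    using assms is_cycle_on_finite finite_subset by (fastforce simp: splitting_subset_def)
  then show "finite ((T ^^ i) ` W)" for i
    by simp
  have "card ((T ^^ i) ` W) = card S div d" for i
    using card_image[OF inj_on_subset[OF bij_is_inj[OF is_cycle_on_bij[OF assms(1)]] subset_UNIV]]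
      assms(3) by (simp add: splitting_subset_def)
  then show "card (\<Union>i<d. (T ^^ i) ` W) = (\<Sum>i<d. card ((T ^^ i) ` W))"
    using assms(2,3) by (simp add: splitting_subset_def)
qed (use assms in auto)

text \<open>Closure of W under \<open>T ^^ d\<close> puts the whole orbit of x inside W; the two
  sets have the same finite size.\<close>

lemma splitting_subset_eq_power_orbit:
  assumes "is_cycle_on T S" "d > 0" "d dvd card S" "splitting_subset d T S W" "x \<in> W"
  shows "W = power_orbit d T x"
proof -
  have W: "W \<subseteq> S" "card W = card S div d" "(\<Union>i<d. (T ^^ i) ` W) = S"
    using assms(4) by (auto simp: splitting_subset_def)
  have step: "(T ^^ d) w \<in> W" if "w \<in> W" for w
  proof -
    have "(T ^^ d) w \<in> S"
      using is_cycle_on_funpow_in[OF assms(1)] W(1) that by auto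
    then obtain i v where iv: "i < d" "v \<in> W" "(T ^^ d) w = (T ^^ i) v"
      using W(3) by blast
    have "i = 0"
    proof (rule ccontr)
      assume "i \<noteq> 0"
      have "(T ^^ i) ((T ^^ (d - i)) w) = (T ^^ i) v"
        using iv by (metis comp_apply funpow_add le_add_diff_inverse less_imp_le)
      then have "(T ^^ (d - i)) w = v"
        using is_cycle_on_bij[OF assms(1)] by (meson bij_is_inj injD)
      then have "v \<in> (T ^^ (d - i)) ` W \<inter> (T ^^ 0) ` W"
        using iv that by auto
      moreover have "(T ^^ (d - i)) ` W \<inter> (T ^^ 0) ` W = {}"
        using iv(1) \<open>i \<noteq> 0\<close> by (intro splitting_subset_disjoint[OF assms(1,3,4)]) auto
      ultimately show False
        by blast
    qed
    then show ?thesis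
      using iv by simp
  qed
  have "(T ^^ (d * j)) x \<in> W" for j
  proof (induction j)
    case (Suc j)
    then show ?case
      using step by (simp add: funpow_add)
  qed (use assms(5) in simp)
  then have "power_orbit d T x \<subseteq> W"
    by (auto simp: power_orbit_def)
  moreover have "card (power_orbit d T x) = card W"
    using card_power_orbit[OF assms(1) _ assms(2,3), of x] W assms(5) by auto
  moreover have "finite W"
    using W(1) is_cycle_on_finite[OF assms(1)] finite_subset by blast
  ultimately show ?thesis
    using card_subset_eq by metis
qed

text \<open>The splitting subsets are exactly the d translates of a single orbit
  \<open>?O\<close>.\<close>

lemma num_splitting_cycle:
  assumes "is_cycle_on T S" "S \<noteq> {}" "d > 0" "d dvd card S"
  shows "num_splitting d T S = d"
proof -
  obtain x where x: "x \<in> S"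
    using assms(2) by blast
  let ?O = "power_orbit d T x"
  have O: "splitting_subset d T S ?O"
    using splitting_subset_power_orbit assms x by metis
  have iO: "splitting_subset d T S ((T ^^ i) ` ?O)" for i
    unfolding funpow_image_power_orbit
    using splitting_subset_power_orbit is_cycle_on_funpow_in assms x by metis
  have "{W. splitting_subset d T S W} = (\<lambda>i. (T ^^ i) ` ?O) ` {..<d}"
  proof (intro subset_antisym subsetI)
    fix W assume "W \<in> {W. splitting_subset d T S W}"
    then have W: "splitting_subset d T S W"
      by simp
    then have "W \<noteq> {}"
      using assms(2) by (auto simp: splitting_subset_def)
    then obtain w where w: "w \<in> W"
      by blast
    then have "w \<in> (\<Union>i<d. (T ^^ i) ` ?O)"
      using W O by (auto simp: splitting_subset_def)
    then obtain i where i: "i < d" "w \<in> (T ^^ i) ` ?O"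
      by blast
    \<comment> \<open>Both sides are splitting subsets containing w, so both equal
      \<open>power_orbit d T w\<close>.\<close>
    have "W = (T ^^ i) ` ?O"
      using splitting_subset_eq_power_orbit[OF assms(1,3,4)] W w iO i(2) by metis
    then show "W \<in> (\<lambda>i. (T ^^ i) ` ?O) ` {..<d}"
      using i(1) by blast
  qed (use iO in auto)
  moreover have "inj_on (\<lambda>i. (T ^^ i) ` ?O) {..<d}"
  proof (rule inj_onI)
    fix i j assume "i \<in> {..<d}" "j \<in> {..<d}" "(T ^^ i) ` ?O = (T ^^ j) ` ?O"
    \<comment> \<open>Equal translates with distinct indices would be disjoint from themselves, yet
      both are nonempty.\<close>
    then show "i = j"
      using splitting_subset_disjoint[OF assms(1,4) O, of i j] in_power_orbit[of x d T] by auto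
  qed
  ultimately show ?thesis
    by (simp add: num_splitting_def card_image)
qed

section \<open>Flags of a cycle\<close>

text \<open>Each flag determines its exponent tuple, so the coefficients count the fibres of a map
  on flags, and the sum over tuples can be regrouped as a sum over flags.\<close>

lemma flag_genfun_altdef:
  fixes t :: "nat \<Rightarrow> 'b::comm_semiring_1"
  assumes "finite S"
  shows "flag_genfun d T S t =
    (\<Sum>U\<in>invariant_flags d T S. \<Prod>i=1..d. t i ^ (card (U i) - card (U (i - 1))))"
proof -
  let ?F = "invariant_flags d T S"
  \<comment> \<open>The exponent tuple of a flag, made extensional to match the tuples J. At i = 1
    the subtracted term is the size of \<open>U 0\<close>, which is empty.\<close>
  define D :: "(nat \<Rightarrow> 'a set) \<Rightarrow> nat \<Rightarrow> nat"
    where "D U = (\<lambda>i\<in>{1..d}. card (U i) - card (U (i - 1)))" for U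
  have D_iff: "(\<forall>i\<in>{1..d}. card (U i) = (\<Sum>k=1..i. J k)) \<longleftrightarrow> D U = J"
    if U: "U \<in> ?F" and J: "J \<in> {1..d} \<rightarrow>\<^sub>E UNIV" for U J
  proof
    assume sums: "\<forall>i\<in>{1..d}. card (U i) = (\<Sum>k=1..i. J k)"
    \<comment> \<open>Index 0 is added, where both sides are 0, so that the first difference can be
      treated like the others.\<close>
    have sums': "card (U i) = (\<Sum>k=1..i. J k)" if "i \<le> d" for i
      using that sums U by (cases "i = 0") (auto simp: invariant_flags_def)
    show "D U = J"
    proof
      fix i show "D U i = J i"
      proof (cases "i \<in> {1..d}")
        case True
        then obtain k where "i = Suc k"
          by (cases i) auto
        then show ?thesis
          using True sums'[of i] sums'[of k] by (simp add: D_def)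
      qed (use J in \<open>auto simp: D_def PiE_def extensional_def\<close>)
    qed
  next
    assume DJ: "D U = J"
    have "card (U i) = (\<Sum>k=1..i. J k)" if "i \<le> d" for i
      using that
    proof (induction i)
      case 0
      then show ?case
        using U by (simp add: invariant_flags_def)
    next
      case (Suc i)
      have "U (Suc i) \<in> {V. invariant_subset T S V}" "U i \<subseteq> U (Suc i)"
        using Suc.prems U by (auto simp: invariant_flags_def)
      \<comment> \<open>Monotonicity ensures that the natural-number subtraction in \<open>D\<close>
        does not truncate.\<close>
      then have "card (U i) \<le> card (U (Suc i))"
        using assms by (intro card_mono) (auto simp: invariant_subset_def finite_subset)
      moreover have "J (Suc i) = card (U (Suc i)) - card (U i)"
        using Suc.prems by (simp add: D_def flip: DJ)
      ultimately show ?case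
        using Suc by simp
    qed
    then show "\<forall>i\<in>{1..d}. card (U i) = (\<Sum>k=1..i. J k)"
      by simp
  qed
  have fin: "finite ?F"
    using assms by (rule finite_invariant_flags)
  have num: "num_flags d T S J = card {U \<in> ?F. D U = J}" if "J \<in> {1..d} \<rightarrow>\<^sub>E UNIV" for J
    unfolding num_flags_def using D_iff that by (intro arg_cong[where f = card]) blast
  have D_in: "D U \<in> {1..d} \<rightarrow>\<^sub>E UNIV" for U
    by (simp add: D_def)
  have "{J. J \<in> {1..d} \<rightarrow>\<^sub>E UNIV \<and> num_flags d T S J \<noteq> 0} = D ` ?F"
  proof (intro subset_antisym subsetI)
    fix J assume "J \<in> {J. J \<in> {1..d} \<rightarrow>\<^sub>E UNIV \<and> num_flags d T S J \<noteq> 0}"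
    then have "card {U \<in> ?F. D U = J} \<noteq> 0"
      using num[of J] by simp
    then have "{U \<in> ?F. D U = J} \<noteq> {}"
      by (metis card.empty)
    then show "J \<in> D ` ?F"
      by blast
  next
    fix J assume "J \<in> D ` ?F"
    then have "{U \<in> ?F. D U = J} \<noteq> {}" "J \<in> {1..d} \<rightarrow>\<^sub>E UNIV"
      using D_in by auto
    then show "J \<in> {J. J \<in> {1..d} \<rightarrow>\<^sub>E UNIV \<and> num_flags d T S J \<noteq> 0}"
      using num[of J] fin by (simp add: card_gt_0_iff)
  qed
  then have "flag_genfun d T S t =
      (\<Sum>J\<in>D ` ?F. of_nat (card {U \<in> ?F. D U = J}) * (\<Prod>i=1..d. t i ^ J i))"
    unfolding flag_genfun_def
  proof (rule sum.cong)
    fix J assume "J \<in> D ` ?F"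
    then have "num_flags d T S J = card {U \<in> ?F. D U = J}"
      using num D_in by blast
    then show "of_nat (num_flags d T S J) * (\<Prod>i=1..d. t i ^ J i) =
        of_nat (card {U \<in> ?F. D U = J}) * (\<Prod>i=1..d. t i ^ J i)"
      by simp
  qed
  also have "\<dots> = (\<Sum>J\<in>D ` ?F. \<Sum>U\<in>{U \<in> ?F. D U = J}. \<Prod>i=1..d. t i ^ D U i)"
    by simp
  also have "\<dots> = (\<Sum>U\<in>?F. \<Prod>i=1..d. t i ^ D U i)"
    using fin by (rule sum.image_gen[symmetric])
  finally show ?thesis
    by (simp add: D_def)
qed

text \<open>A flag takes only the values empty and S and is increasing, so the index k of its first
  S determines it. Since S is nonempty, \<open>U 0 = {}\<close> forces k >= 1.\<close>

lemma invariant_flags_cycle: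
  assumes "is_cycle_on T S" "S \<noteq> {}"
  shows "invariant_flags d T S = (\<lambda>k. \<lambda>i\<in>{0..d}. if i < k then {} else S) ` {1..d}"
    (is "_ = ?u ` _")
proof (intro subset_antisym subsetI)
  fix U assume U: "U \<in> invariant_flags d T S"
  define k where "k = (LEAST i. U i = S)"
  have U0: "U 0 = {}" and Ud: "U d = S" and mono: "\<And>i. i < d \<Longrightarrow> U i \<subseteq> U (Suc i)"
    and UE: "U \<in> {0..d} \<rightarrow>\<^sub>E {V. invariant_subset T S V}"
    using U by (auto simp: invariant_flags_def)
  have cases: "U i = {} \<or> U i = S" if "i \<le> d" for i
    using UE that is_cycle_on_invariant_subset_iff[OF assms(1)] by (auto simp: PiE_def Pi_def)
  have k: "U k = S" "k \<le> d"
    unfolding k_def using Ud by (rule LeastI, rule Least_le)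
  have "k \<noteq> 0"
    using k(1) U0 assms(2) by metis
  have lt: "U i = {}" if "i < k" for i
    using that cases[of i] k(2) not_less_Least[of i "\<lambda>i. U i = S"] by (auto simp: k_def)
  have ge: "U i = S" if "k \<le> i" "i \<le> d" for i
    using that
  proof (induction i rule: dec_induct)
    case (step i)
    then show ?case
      using mono[of i] cases[of "Suc i"] assms(2) by auto
  qed (use k in simp)
  have "U = ?u k"
    using lt ge UE by (auto simp: fun_eq_iff PiE_def extensional_def)
  then show "U \<in> ?u ` {1..d}"
    using \<open>k \<noteq> 0\<close> k(2) by auto
next
  fix U assume "U \<in> ?u ` {1..d}"
  then obtain k where k: "1 \<le> k" "k \<le> d" "U = ?u k"
    by auto
  have "U \<in> {0..d} \<rightarrow>\<^sub>E {V. invariant_subset T S V}"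
    unfolding k(3) is_cycle_on_invariant_subset_iff[OF assms(1)] by simp
  moreover have "U 0 = {}" "U d = S"
    using k by simp_all
  moreover have "\<forall>i<d. U i \<subseteq> U (Suc i)"
    unfolding k(3) by simp
  ultimately show "U \<in> invariant_flags d T S"
    by (simp add: invariant_flags_def)
qed

text \<open>The flag jumping at k has a single nonzero size difference, \<open>card S\<close> at
  position k, and so contributes the monomial \<open>t k ^ card S\<close>.\<close>

lemma flag_genfun_cycle:
  fixes t :: "nat \<Rightarrow> 'b::comm_semiring_1"
  assumes "is_cycle_on T S" "S \<noteq> {}"
  shows "flag_genfun d T S t = (\<Sum>k=1..d. t k ^ card S)"
proof -
  let ?u = "\<lambda>k. \<lambda>i\<in>{0..d}. if i < k then {} else S"
  have "inj_on ?u {1..d}"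
  proof (rule inj_onI)
    fix k l assume kl: "k \<in> {1..d}" "l \<in> {1..d}" "?u k = ?u l"
    show "k = l"
    proof (rule ccontr)
      assume "k \<noteq> l"
      \<comment> \<open>At the smaller of the two jump indices one flag has already reached S while
        the other is still empty.\<close>
      then have "?u k (min k l) \<noteq> ?u l (min k l)"
        using kl(1,2) assms(2) by (auto simp: min_def)
      then show False
        using kl(3) by metis
    qed
  qed
  then have "flag_genfun d T S t =
      (\<Sum>k=1..d. \<Prod>i=1..d. t i ^ (card (?u k i) - card (?u k (i - 1))))"
    unfolding flag_genfun_altdef[OF is_cycle_on_finite[OF assms(1)]] invariant_flags_cycle[OF assms]
    by (simp only: sum.reindex o_def)
  also have "\<dots> = (\<Sum>k=1..d. \<Prod>i=1..d. if i = k then t i ^ card S else 1)"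
    by (intro sum.cong prod.cong) auto
  also have "\<dots> = (\<Sum>k=1..d. t k ^ card S)"
    by (intro sum.cong) auto
  finally show ?thesis .
qed

theorem theorem3p8:
  fixes d n :: nat and \<zeta> :: complex and T :: "nat \<Rightarrow> nat"
  assumes "d > 0" and "n > 0" and "d dvd n"
    and "primitive_root_of_unity d \<zeta>"
    and "is_cycle_on T {1..n}"
  shows "of_nat (num_splitting d T {1..n}) = flag_genfun d T {1..n} (\<lambda>i. \<zeta> ^ i)"
proof -
  have "(\<zeta> ^ k) ^ n = 1" for k
  proof -
    \<comment> \<open>Since d divides n, this is a power of \<open>\<zeta> ^ d = 1\<close>; hence
      each of the d flags contributes 1.\<close>
    have "\<zeta> ^ n = 1"
      using assms(3,4) by (auto simp: primitive_root_of_unity_def power_mult elim!: dvdE)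
    then show ?thesis
      by (metis mult.commute power_mult power_one)
  qed
  then have "flag_genfun d T {1..n} (\<lambda>i. \<zeta> ^ i) = of_nat d"
    using flag_genfun_cycle[OF assms(5), of d "\<lambda>i. \<zeta> ^ i"] assms(2) by simp
  then show ?thesis
    using num_splitting_cycle[OF assms(5)] assms(1-3) by simp
qed

end
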